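(* Let $a,b$ be integers with $a\ge 1$, $b\ge 0$. Then for any positive integer $n$, $$S_n(1,\{2\}^b)=2\sum_{k=1}^n\frac{\binom{n}{k}}{k^{2b+1}\binom{n+k}{k}},$$ $$S_n(\{2\}^a,1,\{2\}^b)=2\sum_{k=1}^n\frac{(-1)^{k-1}\binom{n}{k}}{k^{2(a+b)+1}\binom{n+k}{k}}-4\sum_{k=1}^n\frac{H_{k-1}(-2a)\binom{n}{k}}{k^{2b+1}\binom{n+k}{k}}.$$
   Context: For a sequence $(s_1,\dots,s_r)$ of positive integers and an integer $n\ge 0$, $S_n(s_1,\dots,s_r)=\sum_{1\le k_1\le\cdots\le k_r\le n}\frac{1}{k_1^{s_1}\cdots k_r^{s_r}}$. For a positive integer $s$, $H_n(-s)=\sum_{k=1}^n\frac{(-1)^k}{k^{s}}$ (so $H_0(-s)=0$). $\{2\}^a$ denotes $2$ repeated $a$ times. *)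

theory Defs imports Complex_Main begin

text \<open>Multiple harmonic star sums \<open>S_n(s_1, \<dots>, s_r)\<close>, summed over the weakly increasing
  index tuples \<open>1 \<le> k_1 \<le> \<dots> \<le> k_r \<le> n\<close>, represented as sorted lists.\<close>

definition star_indices :: "nat \<Rightarrow> nat \<Rightarrow> nat list set" where
  "star_indices n r = {ks. length ks = r \<and> sorted ks \<and> set ks \<subseteq> {1..n}}"

definition star_sum :: "nat \<Rightarrow> nat list \<Rightarrow> real" where
  "star_sum n s =
     (\<Sum>ks\<in>star_indices n (length s). 1 / (\<Prod>i<length s. real (ks ! i) ^ (s ! i)))"

lemma finite_star_indices: "finite (star_indices n r)"
proof (rule finite_subset)
  show "star_indices n r \<subseteq> {ks. set ks \<subseteq> {1..n} \<and> length ks = r}"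
    by (auto simp: star_indices_def)
  show "finite {ks. set ks \<subseteq> {1..n} \<and> length ks = r}"
    by (rule finite_lists_length_eq) simp
qed

text \<open>\<open>alt_harmonic n s\<close> is the alternating harmonic number \<open>H_n(-s)\<close>; the minus sign of the
  index is part of the notation, so the argument \<open>s\<close> is positive.\<close>

definition alt_harmonic :: "nat \<Rightarrow> nat \<Rightarrow> real" where
  "alt_harmonic n s = (\<Sum>k=1..n. (-1) ^ k / real k ^ s)"

end

theory Submission imports Defs begin

text \<open>
  Write \<open>R n k = (n choose k) / ((n + k) choose k) = n!\<^sup>2 / ((n - k)! (n + k)!)\<close>.
  Star sums are determined by peeling off the largest index:
  \<open>S_n(s, t) - S_{n-1}(s, t) = S_n(s) / n\<^sup>t\<close>. The ratio satisfies
  \<open>R n k - R (n - 1) k = (k\<^sup>2 / n\<^sup>2) R n k\<close>. So if \<open>S_n(s)\<close> has for \<open>n \<ge> 1\<close> an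
  expansion \<open>\<Sum>k=1..n. c k * R n k\<close> with coefficients independent of \<open>n\<close>, then appending an exponent \<open>2\<close> to
  \<open>s\<close> merely divides each \<open>c k\<close> by \<open>k\<^sup>2\<close> (\<open>star_sum_snoc_two\<close>). Both claims are thereby reduced
  to \<open>b = 0\<close>, and the expansion of \<open>S_n({2}\<^sup>a)\<close> to the alternating sum
  \<open>2 * (\<Sum>k=1..n. (-1)^(k-1) * R n k) = 1\<close>, that is, to the value of the empty star sum.

  The exponent \<open>1\<close> is handled by the recurrence in the other variable,
  \<open>(n + k + 1) R n (k + 1) = (n - k) R n k\<close>. It makes both \<open>2 k R n k\<close> and
  \<open>2 n (-1)^k R n k\<close> telescope in \<open>k\<close>. For \<open>S_n({2}\<^sup>a, 1)\<close>, summation by parts against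
  the first telescope turns the partial sums \<open>H_{k-1}(-2a)\<close> into the single terms
  \<open>(-1)^k / k^(2a)\<close>; they combine with the other alternating sum so that \<open>2 k + 2 (n - k) = 2 n\<close>
  appears, and the increment in \<open>n\<close> is the expansion of \<open>S_n({2}\<^sup>a)\<close>, divided by \<open>n\<close>.
\<close>

section \<open>Peeling the largest index off a star sum\<close>

lemma star_indices_0: "star_indices n 0 = {[]}"
  by (auto simp: star_indices_def)

lemma star_sum_Nil: "star_sum n [] = 1"
  by (simp add: star_sum_def star_indices_0)

lemma star_sum_0_snoc: "star_sum 0 (s @ [t]) = 0"
proof -
  have "star_indices 0 (length (s @ [t])) = {}"
    by (auto simp: star_indices_def)
  then show ?thesis by (simp add: star_sum_def)
qed

text \<open>Only weak monotonicity is required, so once the last entry is \<open>n + 1\<close> the bound on the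
  remaining entries stays \<open>n + 1\<close>. This is why the peeled recursion below evaluates the shorter
  star sum at \<open>n + 1\<close> rather than at \<open>n\<close>.\<close>

lemma star_indices_Suc_Suc:
  "star_indices (Suc n) (Suc r) =
     star_indices n (Suc r) \<union> (\<lambda>ks. ks @ [Suc n]) ` star_indices (Suc n) r"
proof (intro equalityI subsetI)
  fix ks assume ks: "ks \<in> star_indices (Suc n) (Suc r)"
  then have len: "length ks = Suc r" by (simp add: star_indices_def)
  obtain ls x where eq: "ks = ls @ [x]"
    using len by (metis length_Suc_conv_rev)
  have facts: "length ls = r" "sorted ls" "\<forall>y\<in>set ls. y \<le> x" "set ls \<subseteq> {1..Suc n}"
      "x \<in> {1..Suc n}"
    using ks by (auto simp: star_indices_def eq sorted_append)
  show "ks \<in> star_indices n (Suc r) \<union> (\<lambda>ks. ks @ [Suc n]) ` star_indices (Suc n) r"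
  proof (cases "x = Suc n")
    case True
    then show ?thesis using facts by (auto simp: star_indices_def eq)
  next
    case False
    then have "x \<le> n" using facts by auto
    then have "set ls \<subseteq> {1..n}" using facts by fastforce
    then show ?thesis using facts \<open>x \<le> n\<close> by (auto simp: star_indices_def eq sorted_append)
  qed
next
  fix ks assume "ks \<in> star_indices n (Suc r) \<union> (\<lambda>ks. ks @ [Suc n]) ` star_indices (Suc n) r"
  then show "ks \<in> star_indices (Suc n) (Suc r)"
    by (force simp: star_indices_def sorted_append)
qed

lemma star_sum_Suc_snoc:
  "star_sum (Suc n) (s @ [t]) =
     star_sum n (s @ [t]) + star_sum (Suc n) s / real (Suc n) ^ t"
proof -
  let ?r = "length s"
  define w where "w ks = 1 / (\<Prod>i<Suc ?r. real (ks ! i) ^ ((s @ [t]) ! i))" for ks :: "nat list"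
  have disj: "star_indices n (Suc ?r) \<inter> (\<lambda>ks. ks @ [Suc n]) ` star_indices (Suc n) ?r = {}"
    by (auto simp: star_indices_def)
  have w_snoc: "w (ks @ [Suc n]) =
      1 / (\<Prod>i<?r. real (ks ! i) ^ (s ! i)) / real (Suc n) ^ t"
    if "ks \<in> star_indices (Suc n) ?r" for ks
  proof -
    have "length ks = ?r" using that by (simp add: star_indices_def)
    then show ?thesis by (simp add: w_def nth_append del: of_nat_Suc)
  qed
  have "star_sum (Suc n) (s @ [t]) =
      sum w (star_indices n (Suc ?r)) +
      sum w ((\<lambda>ks. ks @ [Suc n]) ` star_indices (Suc n) ?r)"
    unfolding star_sum_def length_append_singleton star_indices_Suc_Suc w_def[symmetric]
    by (rule sum.union_disjoint) (use disj in \<open>auto simp: finite_star_indices\<close>)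
  also have "sum w (star_indices n (Suc ?r)) = star_sum n (s @ [t])"
    by (simp add: star_sum_def w_def)
  also have "sum w ((\<lambda>ks. ks @ [Suc n]) ` star_indices (Suc n) ?r) =
      (\<Sum>ks\<in>star_indices (Suc n) ?r. w (ks @ [Suc n]))"
    by (subst sum.reindex) (auto simp: inj_on_def)
  also have "\<dots> = star_sum (Suc n) s / real (Suc n) ^ t"
    by (simp add: w_snoc star_sum_def sum_divide_distrib del: of_nat_Suc)
  finally show ?thesis .
qed

lemma star_sum_snoc_eqI:
  assumes "F 0 = 0"
    and "\<And>n. F (Suc n) = F n + star_sum (Suc n) s / real (Suc n) ^ t"
  shows "star_sum n (s @ [t]) = F n"
  by (induction n) (simp_all add: assms star_sum_0_snoc star_sum_Suc_snoc del: of_nat_Suc)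

section \<open>Recurrences for the ratio of binomial coefficients\<close>

definition binom_ratio :: "nat \<Rightarrow> nat \<Rightarrow> real" where
  "binom_ratio n k = real (n choose k) / real ((n + k) choose k)"

lemma binom_ratio_0 [simp]: "binom_ratio n 0 = 1"
  by (simp add: binom_ratio_def)

lemma binom_ratio_eq_0 [simp]: "n < k \<Longrightarrow> binom_ratio n k = 0"
  by (simp add: binom_ratio_def)

lemma binom_ratio_Suc_right:
  "real (n + Suc k) * binom_ratio n (Suc k) = (real n - real k) * binom_ratio n k"
proof (cases "k \<le> n")
  case True
  have "Suc k * (n choose Suc k) = (n - k) * (n choose k)"
    by (metis binomial_absorb_comp binomial_absorption mult.commute)
  then have num: "real (Suc k) * real (n choose Suc k) = (real n - real k) * real (n choose k)"
    using True by (metis of_nat_diff of_nat_mult)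
  have "Suc k * ((n + Suc k) choose Suc k) = (n + Suc k) * ((n + k) choose k)"
    using Suc_times_binomial_eq[of "n + k" k] by (simp add: algebra_simps)
  then have den: "real (Suc k) * real ((n + Suc k) choose Suc k) =
      real (n + Suc k) * real ((n + k) choose k)"
    by (metis of_nat_mult)
  have "real (n + Suc k) * binom_ratio n (Suc k) =
      real (n + Suc k) * (real (Suc k) * real (n choose Suc k)) /
      (real (Suc k) * real ((n + Suc k) choose Suc k))"
    by (simp add: binom_ratio_def del: of_nat_Suc of_nat_add binomial_Suc_Suc add_Suc_right)
  also have "\<dots> = (real n - real k) * binom_ratio n k"
    unfolding num den by (simp add: binom_ratio_def del: of_nat_Suc of_nat_add)
  finally show ?thesis .
qed simp

lemma binom_ratio_Suc_left:
  "binom_ratio (Suc n) k =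
     binom_ratio n k + (real k)\<^sup>2 / (real (Suc n))\<^sup>2 * binom_ratio (Suc n) k"
proof (cases "k \<le> Suc n")
  case True
  let ?N = "real (Suc n)"
  have "Suc n * (n choose k) = (Suc n - k) * (Suc n choose k)"
    using binomial_absorb_comp[of "Suc n" k] by simp
  then have num: "?N * real (n choose k) = (?N - real k) * real (Suc n choose k)"
    using True by (metis of_nat_diff of_nat_mult)
  have "(Suc n + k) * ((n + k) choose k) = Suc n * ((Suc n + k) choose k)"
    using binomial_absorb_comp[of "Suc n + k" k] by simp
  then have den: "(?N + real k) * real ((n + k) choose k) = ?N * real ((Suc n + k) choose k)"
    by (metis of_nat_add of_nat_mult)
  have pos: "?N > 0" "?N + real k > 0" "real ((n + k) choose k) > 0" by auto
  have "?N\<^sup>2 * binom_ratio n k =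
      (?N * (?N + real k)) * (?N * real (n choose k)) /
      ((?N + real k) * real ((n + k) choose k))"
    using pos by (simp add: binom_ratio_def power2_eq_square del: of_nat_Suc)
  also have "\<dots> = (?N\<^sup>2 - (real k)\<^sup>2) * binom_ratio (Suc n) k"
    unfolding num den using pos
    by (simp add: binom_ratio_def power2_eq_square square_diff_square_factored
        del: of_nat_Suc binomial_Suc_Suc add_Suc)
  finally show ?thesis using pos by (simp add: field_simps del: of_nat_Suc)
qed simp

section \<open>Sums in the lower variable\<close>

text \<open>Summation by parts against \<open>2 k R n k = (n + k) R n k - (n + k + 1) R n (k + 1)\<close>. The
  second term of this difference equals \<open>(n - k) R n k\<close>, which vanishes at \<open>k = n\<close>, so there is
  no boundary term.\<close>

lemma sum_partial_sums_binom_ratio: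
  fixes f :: "nat \<Rightarrow> real"
  shows "(\<Sum>k=1..n. 2 * real k * (\<Sum>j=1..k - 1. f j) * binom_ratio n k) =
     (\<Sum>k=1..n. f k * (real n - real k) * binom_ratio n k)"
proof -
  have "(\<Sum>k=1..m. 2 * real k * (\<Sum>j=1..k - 1. f j) * binom_ratio n k) =
      (\<Sum>k=1..m. f k * (real n - real k) * binom_ratio n k) -
      (\<Sum>j=1..m. f j) * ((real n - real m) * binom_ratio n m)" for m
  proof (induction m)
    case (Suc m)
    have "(\<Sum>j=1..m. f j) * ((real n - real m) * binom_ratio n m) =
        (\<Sum>j=1..m. f j) * (real (n + Suc m) * binom_ratio n (Suc m))"
      by (simp only: binom_ratio_Suc_right)
    with Suc.IH show ?case by (simp add: algebra_simps)
  qed simp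
  from this[of n] show ?thesis by simp
qed

lemma sum_times_binom_ratio: "2 * (\<Sum>k=1..n. real k * binom_ratio n k) = real n"
proof -
  have "2 * (\<Sum>k=1..m. real k * binom_ratio n k) =
      real n - (real n - real m) * binom_ratio n m" for m
  proof (induction m)
    case (Suc m)
    then show ?case using binom_ratio_Suc_right[of n m] by (simp add: algebra_simps)
  qed simp
  from this[of n] show ?thesis by simp
qed

lemma alternating_sum_binom_ratio:
  assumes "n \<ge> 1"
  shows "2 * (\<Sum>k=1..n. (-1) ^ (k - 1) * binom_ratio n k) = 1"
proof -
  \<comment> \<open>With \<open>U k = (-1)^(k-1) (n + k) R n k\<close>, the terms are \<open>U k - U (k + 1)\<close> because
      \<open>(n + k) + (n - k) = 2 n\<close>.\<close>
  have "2 * real n * (\<Sum>k=1..m. (-1) ^ (k - 1) * binom_ratio n k) =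
      real n - (-1) ^ m * ((real n - real m) * binom_ratio n m)" for m
  proof (induction m)
    case (Suc m)
    have "(-1) ^ m * ((real n - real m) * binom_ratio n m) =
        (-1) ^ m * (real (n + Suc m) * binom_ratio n (Suc m))"
      by (simp only: binom_ratio_Suc_right)
    with Suc.IH show ?case by (simp add: algebra_simps)
  qed simp
  from this[of n] show ?thesis using assms by simp
qed

section \<open>Expansions of star sums in the binomial ratios\<close>

text \<open>The coefficients do not depend on \<open>n\<close>, so the increment in \<open>n\<close> is taken on the ratios alone,
  where it multiplies the \<open>k\<close>-th term by \<open>k\<^sup>2 / n\<^sup>2\<close>.\<close>

lemma sum_binom_ratio_Suc:
  fixes c :: "nat \<Rightarrow> real"
  shows "(\<Sum>k=1..Suc n. c k * binom_ratio (Suc n) k) =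
     (\<Sum>k=1..n. c k * binom_ratio n k) +
     (\<Sum>k=1..Suc n. c k * (real k)\<^sup>2 * binom_ratio (Suc n) k) / (real (Suc n))\<^sup>2"
proof -
  have "(\<Sum>k=1..Suc n. c k * binom_ratio (Suc n) k) =
      (\<Sum>k=1..Suc n. c k * binom_ratio n k +
         c k * (real k)\<^sup>2 * binom_ratio (Suc n) k / (real (Suc n))\<^sup>2)"
  proof (rule sum.cong[OF refl])
    fix k
    show "c k * binom_ratio (Suc n) k = c k * binom_ratio n k +
        c k * (real k)\<^sup>2 * binom_ratio (Suc n) k / (real (Suc n))\<^sup>2"
      by (subst binom_ratio_Suc_left) (simp add: algebra_simps del: of_nat_Suc)
  qed
  also have "\<dots> = (\<Sum>k=1..Suc n. c k * binom_ratio n k) +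
      (\<Sum>k=1..Suc n. c k * (real k)\<^sup>2 * binom_ratio (Suc n) k) / (real (Suc n))\<^sup>2"
    by (simp only: sum.distrib sum_divide_distrib)
  finally show ?thesis by simp
qed

lemma star_sum_snoc_two:
  assumes "\<And>n. n \<ge> 1 \<Longrightarrow> star_sum n s = (\<Sum>k=1..n. c k * binom_ratio n k)"
  shows "star_sum n (s @ [2]) = (\<Sum>k=1..n. c k / (real k)\<^sup>2 * binom_ratio n k)"
proof (rule star_sum_snoc_eqI)
  fix n
  have "(\<Sum>k=1..Suc n. c k / (real k)\<^sup>2 * (real k)\<^sup>2 * binom_ratio (Suc n) k) =
      (\<Sum>k=1..Suc n. c k * binom_ratio (Suc n) k)"
    by (rule sum.cong) auto
  also have "\<dots> = star_sum (Suc n) s" by (simp add: assms)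
  finally show "(\<Sum>k=1..Suc n. c k / (real k)\<^sup>2 * binom_ratio (Suc n) k) =
      (\<Sum>k=1..n. c k / (real k)\<^sup>2 * binom_ratio n k) + star_sum (Suc n) s / (real (Suc n))\<^sup>2"
    by (simp only: sum_binom_ratio_Suc[of "\<lambda>k. c k / (real k)\<^sup>2"])
qed simp

lemma star_sum_append_replicate_two:
  assumes "\<And>n. n \<ge> 1 \<Longrightarrow> star_sum n s = (\<Sum>k=1..n. c k * binom_ratio n k)"
    and "n \<ge> 1"
  shows "star_sum n (s @ replicate b 2) = (\<Sum>k=1..n. c k / real k ^ (2 * b) * binom_ratio n k)"
  using assms(2)
proof (induction b arbitrary: n)
  case 0
  then show ?case by (simp add: assms(1))
next
  case (Suc b)
  have "s @ replicate (Suc b) 2 = (s @ replicate b 2) @ [2]"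
    by (simp add: replicate_append_same)
  then show ?case
    using star_sum_snoc_two[OF Suc.IH, of n]
    by (simp add: power2_eq_square mult_ac)
qed

lemma star_sum_replicate_two:
  assumes "n \<ge> 1"
  shows "star_sum n (replicate a 2) =
    (\<Sum>k=1..n. 2 * (-1) ^ (k - 1) / real k ^ (2 * a) * binom_ratio n k)"
proof -
  have "star_sum m [] = (\<Sum>k=1..m. 2 * (-1) ^ (k - 1) * binom_ratio m k)" if "m \<ge> 1" for m
    using alternating_sum_binom_ratio[OF that]
    by (simp add: star_sum_Nil sum_distrib_left mult.assoc)
  from star_sum_append_replicate_two[OF this assms, of a] show ?thesis by simp
qed

lemma star_sum_one: "star_sum n [1] = (\<Sum>k=1..n. 2 / real k * binom_ratio n k)"
proof -
  have "star_sum n ([] @ [1]) = (\<Sum>k=1..n. 2 / real k * binom_ratio n k)"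
  proof (rule star_sum_snoc_eqI)
    fix n
    have "(\<Sum>k=1..Suc n. 2 / real k * (real k)\<^sup>2 * binom_ratio (Suc n) k) =
        2 * (\<Sum>k=1..Suc n. real k * binom_ratio (Suc n) k)"
      unfolding sum_distrib_left by (rule sum.cong) (auto simp: power2_eq_square)
    also have "\<dots> = real (Suc n)" by (rule sum_times_binom_ratio)
    finally show "(\<Sum>k=1..Suc n. 2 / real k * binom_ratio (Suc n) k) =
        (\<Sum>k=1..n. 2 / real k * binom_ratio n k) + star_sum (Suc n) [] / real (Suc n) ^ 1"
      by (simp only: sum_binom_ratio_Suc[of "\<lambda>k. 2 / real k"] star_sum_Nil)
        (simp add: power2_eq_square del: of_nat_Suc)
  qed simp
  then show ?thesis by simp
qed

text \<open>The increment of the right-hand side in \<open>n\<close> has to be \<open>S_n({2}\<^sup>a) / n\<close>. In it the coefficients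
  are multiplied by \<open>k\<^sup>2 / n\<^sup>2\<close>, which turns the factor \<open>1 / k\<close> of the harmonic part into \<open>k\<close>,
  the weight against which partial sums can be summed by parts.\<close>

lemma star_sum_replicate_two_one:
  "star_sum n (replicate a 2 @ [1]) =
     (\<Sum>k=1..n. (2 * (-1) ^ (k - 1) / real k ^ (2 * a + 1)
        - 4 * alt_harmonic (k - 1) (2 * a) / real k) * binom_ratio n k)"
proof (rule star_sum_snoc_eqI)
  fix n
  let ?N = "Suc n"
  let ?c = "\<lambda>k. 2 * (-1) ^ (k - 1) / real k ^ (2 * a + 1)
        - 4 * alt_harmonic (k - 1) (2 * a) / real k"
  have "(\<Sum>k=1..?N. ?c k * (real k)\<^sup>2 * binom_ratio ?N k) =
      (\<Sum>k=1..?N. 2 * (-1) ^ (k - 1) / real k ^ (2 * a) * real k * binom_ratio ?N k) -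
      2 * (\<Sum>k=1..?N. 2 * real k * alt_harmonic (k - 1) (2 * a) * binom_ratio ?N k)"
    unfolding sum_distrib_left sum_subtractf[symmetric]
    by (rule sum.cong) (auto simp: field_simps power2_eq_square)
  also have "(\<Sum>k=1..?N. 2 * real k * alt_harmonic (k - 1) (2 * a) * binom_ratio ?N k) =
      (\<Sum>k=1..?N. (-1) ^ k / real k ^ (2 * a) * (real ?N - real k) * binom_ratio ?N k)"
    unfolding alt_harmonic_def by (rule sum_partial_sums_binom_ratio)
  also have "(\<Sum>k=1..?N. 2 * (-1) ^ (k - 1) / real k ^ (2 * a) * real k * binom_ratio ?N k) -
      2 * (\<Sum>k=1..?N. (-1) ^ k / real k ^ (2 * a) * (real ?N - real k) * binom_ratio ?N k) =
      real ?N * (\<Sum>k=1..?N. 2 * (-1) ^ (k - 1) / real k ^ (2 * a) * binom_ratio ?N k)"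
    unfolding sum_distrib_left sum_subtractf[symmetric]
  proof (rule sum.cong[OF refl])
    fix k assume "k \<in> {1..?N}"
    then have sgn: "(-1) ^ k = - ((-1) ^ (k - 1) :: real)" by (cases k) auto
    show "2 * (-1) ^ (k - 1) / real k ^ (2 * a) * real k * binom_ratio ?N k -
        2 * ((-1) ^ k / real k ^ (2 * a) * (real ?N - real k) * binom_ratio ?N k) =
        real ?N * (2 * (-1) ^ (k - 1) / real k ^ (2 * a) * binom_ratio ?N k)"
      unfolding sgn by (simp add: algebra_simps diff_divide_distrib del: of_nat_Suc)
  qed
  also have "\<dots> = real ?N * star_sum ?N (replicate a 2)"
    by (simp only: star_sum_replicate_two[of ?N a])
  finally show "(\<Sum>k=1..?N. ?c k * binom_ratio ?N k) =
      (\<Sum>k=1..n. ?c k * binom_ratio n k) + star_sum ?N (replicate a 2) / real ?N ^ 1"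
    by (simp only: sum_binom_ratio_Suc[of ?c])
      (simp add: power2_eq_square del: of_nat_Suc)
qed simp

theorem theorem2p3:
  fixes a b n :: nat
  assumes "a \<ge> 1" and "n \<ge> 1"
  shows "star_sum n (1 # replicate b 2) =
           2 * (\<Sum>k=1..n. real (n choose k) / (real k ^ (2 * b + 1) * real ((n + k) choose k)))
       \<and> star_sum n (replicate a 2 @ 1 # replicate b 2) =
           2 * (\<Sum>k=1..n. (-1) ^ (k - 1) * real (n choose k)
                  / (real k ^ (2 * (a + b) + 1) * real ((n + k) choose k)))
         - 4 * (\<Sum>k=1..n. alt_harmonic (k - 1) (2 * a) * real (n choose k)
                  / (real k ^ (2 * b + 1) * real ((n + k) choose k)))"
proof
  have "star_sum n ([1] @ replicate b 2) =
      (\<Sum>k=1..n. 2 / real k / real k ^ (2 * b) * binom_ratio n k)"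
    by (rule star_sum_append_replicate_two[OF star_sum_one assms(2)])
  then show "star_sum n (1 # replicate b 2) =
      2 * (\<Sum>k=1..n. real (n choose k) / (real k ^ (2 * b + 1) * real ((n + k) choose k)))"
    by (simp add: binom_ratio_def sum_distrib_left mult.assoc)
next
  have "star_sum n ((replicate a 2 @ [1]) @ replicate b 2) =
      (\<Sum>k=1..n. (2 * (-1) ^ (k - 1) / real k ^ (2 * a + 1)
        - 4 * alt_harmonic (k - 1) (2 * a) / real k) / real k ^ (2 * b) * binom_ratio n k)"
    by (rule star_sum_append_replicate_two[OF star_sum_replicate_two_one assms(2)])
  also have "\<dots> =
      2 * (\<Sum>k=1..n. (-1) ^ (k - 1) * real (n choose k)
             / (real k ^ (2 * (a + b) + 1) * real ((n + k) choose k)))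
      - 4 * (\<Sum>k=1..n. alt_harmonic (k - 1) (2 * a) * real (n choose k)
             / (real k ^ (2 * b + 1) * real ((n + k) choose k)))"
    unfolding sum_distrib_left sum_subtractf[symmetric]
    by (rule sum.cong)
      (auto simp: binom_ratio_def diff_divide_distrib power_add algebra_simps)
  finally show "star_sum n (replicate a 2 @ 1 # replicate b 2) =
      2 * (\<Sum>k=1..n. (-1) ^ (k - 1) * real (n choose k)
             / (real k ^ (2 * (a + b) + 1) * real ((n + k) choose k)))
      - 4 * (\<Sum>k=1..n. alt_harmonic (k - 1) (2 * a) * real (n choose k)
             / (real k ^ (2 * b + 1) * real ((n + k) choose k)))"
    by simp
qed

end
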